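(* Fix $T>0$. For a positive integer $n$ and $\beta>0$ let $\tau=T/n$, $c=\beta/\tau^2$ and $\alpha=\frac1\tau+\frac{\tau}{\beta}$, and suppose $c>1$. Let $V$ be the eigenvector matrix of the time-discretization matrix $B$ (both defined in the context), and let $W=V^{-1}$. Then $$\kappa_1(V)=\|V\|_1\,\|W\|_1=\mathcal{O}(cn),$$ i.e. there are a constant $C>0$ depending only on $T$ and an integer $n_0$ such that $\kappa_1(V)\le C\,c\,n$ for all $n\ge n_0$ and all $\beta>0$ with $c=\beta/\tau^2>1$.
   Context: $B\in\mathbb{R}^{(n+1)\times(n+1)}$, with rows and columns indexed by $0,\dots,n$, is the matrix with $B_{0,0}=\alpha$; $B_{0,n}=1/\beta$; $B_{k,0}=-1$ and $B_{k,k}=1/\tau$ for $1\le k\le n$; $B_{k,k-1}=-1/\tau$ for $2\le k\le n$; all other entries $0$. When $\alpha=1/\tau+\tau/\beta$ and $c>1$, the polynomial equation $c+\mu+\mu^2+\cdots+\mu^{n+1}=0$ has $n+1$ distinct complex roots $\mu_1,\dots,\mu_{n+1}$, the eigenvalues of $B$ are the distinct numbers $\lambda_k=(1-1/\mu_k)/\tau$, and $B=V\,\mathrm{diag}(\lambda_1,\dots,\lambda_{n+1})\,V^{-1}$ with the eigenvector matrix $$V=\begin{bmatrix}(\mu_1-1)/\tau&\cdots&(\mu_{n+1}-1)/\tau\\ \mu_1^2-\mu_1&\cdots&\mu_{n+1}^2-\mu_{n+1}\\ \vdots&&\vdots\\ \mu_1^{n+1}-\mu_1&\cdots&\mu_{n+1}^{n+1}-\mu_{n+1}\end{bmatrix}.$$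 $\|\cdot\|_1$ is the matrix $1$-norm (maximum absolute column sum). *)

theory Defs
  imports Complex_Main "Jordan_Normal_Form.Determinant"
    "HOL-Computational_Algebra.Fundamental_Theorem_Algebra"
begin

definition B_mat :: "nat \<Rightarrow> real \<Rightarrow> real \<Rightarrow> real \<Rightarrow> real mat" where
  "B_mat n \<alpha> \<beta> \<tau> = mat (n + 1) (n + 1) (\<lambda>(i, j).
     if i = 0 \<and> j = 0 then \<alpha>
     else if i = 0 \<and> j = n then 1 / \<beta>
     else if 1 \<le> i \<and> j = 0 then - 1
     else if 1 \<le> i \<and> j = i then 1 / \<tau>
     else if 2 \<le> i \<and> j = i - 1 then - 1 / \<tau>
     else 0)"

definition mu_roots :: "nat \<Rightarrow> real \<Rightarrow> complex set" where
  "mu_roots n c = {z. complex_of_real c + (\<Sum>k = 1..n + 1. z ^ k) = 0}"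

text \<open>The roots are enumerated as \<open>\<mu> 1, \<dots>, \<mu> (n + 1)\<close>, whereas matrix indices start from
  \<open>0\<close>; column \<open>j\<close> of the eigenvector matrix therefore belongs to \<open>\<mu> (j + 1)\<close>.\<close>

definition Lambda_mat :: "nat \<Rightarrow> real \<Rightarrow> (nat \<Rightarrow> complex) \<Rightarrow> complex mat" where
  "Lambda_mat n \<tau> \<mu> = mat_diag (n + 1) (\<lambda>j. (1 - 1 / \<mu> (j + 1)) / complex_of_real \<tau>)"

definition V_mat :: "nat \<Rightarrow> real \<Rightarrow> (nat \<Rightarrow> complex) \<Rightarrow> complex mat" where
  "V_mat n \<tau> \<mu> = mat (n + 1) (n + 1) (\<lambda>(i, j).
     if i = 0 then (\<mu> (j + 1) - 1) / complex_of_real \<tau>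
     else \<mu> (j + 1) ^ (i + 1) - \<mu> (j + 1))"

text \<open>Meaningful for matrices with at least one column (\<open>Max {}\<close> is unspecified).\<close>

definition norm_1 :: "complex mat \<Rightarrow> real" where
  "norm_1 A = Max ((\<lambda>j. \<Sum>i<dim_row A. cmod (A $$ (i, j))) ` {..<dim_col A})"

subsection \<open>Well-posedness of the diagonalisation\<close>

lemma geo: "(z - 1) * (\<Sum>k = 1..n + 1. z ^ k) = z ^ (n + 2) - (z :: complex)"
  by (induction n) (auto simp: algebra_simps)

lemma mu_rootsD:
  assumes "z \<in> mu_roots n c"
  shows "z ^ (n + 2) + (complex_of_real c - 1) * z = complex_of_real c"
proof -
  from assms have "(\<Sum>k = 1..n + 1. z ^ k) = - complex_of_real c"
    by (simp add: mu_roots_def add_eq_0_iff)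
  then show ?thesis using geo[of z n] by (simp add: algebra_simps)
qed

lemma zero_one_notin_mu_roots:
  assumes "c > 1"
  shows "0 \<notin> mu_roots n c" "1 \<notin> mu_roots n c"
proof -
  have "(\<Sum>k = 1..n + 1. (0 :: complex) ^ k) = 0"
    by (rule sum.neutral) auto
  then show "0 \<notin> mu_roots n c" using assms by (simp add: mu_roots_def)
  have "complex_of_real c + (\<Sum>k = 1..n + 1. 1 ^ k) = complex_of_real (c + real (n + 1))"
    by simp
  also have "\<dots> \<noteq> 0" unfolding of_real_eq_0_iff using assms by linarith
  finally show "1 \<notin> mu_roots n c" unfolding mu_roots_def by blast
qed

lemma card_mu_roots:
  assumes c: "c > 1"
  shows "finite (mu_roots n c)" "card (mu_roots n c) = n + 1"
proof -
  define p where "p = [:complex_of_real c:] + (\<Sum>k = 1..n + 1. monom 1 k)"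
  define q :: "complex poly" where
    "q = monom 1 (n + 2) + smult (complex_of_real c - 1) (monom 1 1) - [:complex_of_real c:]"
  have poly_p: "poly p z = complex_of_real c + (\<Sum>k = 1..n + 1. z ^ k)" for z
    by (simp add: p_def poly_sum poly_monom)
  have roots: "{z. poly p z = 0} = mu_roots n c"
    by (simp add: poly_p mu_roots_def)
  have pq: "[:- 1, 1:] * p = q"
  proof (rule poly_ext)
    fix z
    have "poly ([:- 1, 1:] * p) z = (z - 1) * complex_of_real c + (z - 1) * (\<Sum>k = 1..n + 1. z ^ k)"
      by (simp add: poly_p algebra_simps)
    also have "\<dots> = poly q z"
      unfolding geo by (simp add: q_def poly_monom algebra_simps)
    finally show "poly ([:- 1, 1:] * p) z = poly q z" .
  qed
  have deg_p: "degree p = n + 1"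
  proof -
    have "coeff p k = (if k = 0 then complex_of_real c else 0) + (if k \<in> {1..n + 1} then 1 else 0)" for k
      by (cases k) (simp_all add: p_def coeff_sum coeff_pCons sum.delta)
    then show ?thesis
      by (intro antisym degree_le le_degree) auto
  qed
  have "rsquarefree p"
    unfolding rsquarefree_roots
  proof (intro allI notI)
    fix z assume z: "poly p z = 0 \<and> poly (pderiv p) z = 0"
    have "poly (pderiv q) z = 0"
      unfolding pq[symmetric] pderiv_mult using z by (simp only: poly_add poly_mult) (simp add: pderiv_pCons)
    then have d: "of_nat (n + 2) * z ^ (n + 1) + (complex_of_real c - 1) = 0"
      by (simp add: q_def pderiv_add pderiv_diff pderiv_smult pderiv_monom poly_monom pderiv_pCons)
    from z have e: "z ^ (n + 2) + (complex_of_real c - 1) * z = complex_of_real c"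
      using roots by (intro mu_rootsD) blast
    have "of_nat (n + 2) * z ^ (n + 2) = z * (of_nat (n + 2) * z ^ (n + 1))"
      by (simp add: algebra_simps)
    also have "\<dots> = z * (1 - complex_of_real c)"
      by (subst eq_neg_iff_add_eq_0[THEN iffD2, OF d]) simp
    finally have zn: "of_nat (n + 2) * z ^ (n + 2) = z * (1 - complex_of_real c)" .
    have "of_nat (n + 2) * complex_of_real c
        = of_nat (n + 2) * z ^ (n + 2) + of_nat (n + 2) * (complex_of_real c - 1) * z"
      using arg_cong[OF e, of "\<lambda>x. of_nat (n + 2) * x"] by (simp only: distrib_left mult.assoc)
    also have "\<dots> = complex_of_real (real (n + 1) * (c - 1)) * z"
      unfolding zn by (simp add: algebra_simps)
    finally have zc: "complex_of_real (real (n + 2) * c) = complex_of_real (real (n + 1) * (c - 1)) * z"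
      by simp
    define x where "x = real (n + 2) * c / (real (n + 1) * (c - 1))"
    have "complex_of_real (real (n + 1) * (c - 1)) \<noteq> 0"
      unfolding of_real_eq_0_iff using c by simp
    then have zx: "z = complex_of_real x"
      unfolding x_def of_real_divide zc by simp
    have "x > 0" using c by (simp add: x_def)
    have "complex_of_real (real (n + 2) * x ^ (n + 1) + (c - 1)) = 0"
      using d by (simp add: zx)
    then have "real (n + 2) * x ^ (n + 1) + (c - 1) = 0"
      by (simp only: of_real_eq_0_iff)
    moreover have "real (n + 2) * x ^ (n + 1) > 0" using \<open>x > 0\<close> by simp
    ultimately show False using c by linarith
  qed
  have p0: "p \<noteq> 0" using deg_p by auto
  from p0 show fin: "finite (mu_roots n c)"
    unfolding roots[symmetric] by (rule poly_roots_finite)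
  have "p = smult (lead_coeff p) (\<Prod>z | poly p z = 0. [:- z, 1:])"
    using complex_poly_decompose_rsquarefree[OF \<open>rsquarefree p\<close>] by simp
  then have "degree p = degree (smult (lead_coeff p) (\<Prod>z | poly p z = 0. [:- z, 1:]))"
    by simp
  also have "\<dots> = card (mu_roots n c)"
    using p0 by (simp add: degree_prod_eq_sum_degree roots)
  finally show "card (mu_roots n c) = n + 1" using deg_p by simp
qed

lemma mu_enumeration_exists:
  assumes "c > 1"
  obtains \<mu> where "bij_betw \<mu> {1..n + 1} (mu_roots n c)"
  using card_mu_roots[OF assms, of n] by (metis ex_bij_betw_nat_finite_1)

lemma B_V_eq_V_Lambda:
  assumes n: "n \<ge> 1" and \<tau>: "\<tau> > 0" and \<beta>: "\<beta> > 0" and c: "\<beta> / \<tau>\<^sup>2 > 1"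
    and \<mu>: "bij_betw \<mu> {1..n + 1} (mu_roots n (\<beta> / \<tau>\<^sup>2))"
  shows "map_mat complex_of_real (B_mat n (1 / \<tau> + \<tau> / \<beta>) \<beta> \<tau>) * V_mat n \<tau> \<mu>
       = V_mat n \<tau> \<mu> * Lambda_mat n \<tau> \<mu>"
proof (rule eq_matI)
  let ?B = "map_mat complex_of_real (B_mat n (1 / \<tau> + \<tau> / \<beta>) \<beta> \<tau>)"
  let ?V = "V_mat n \<tau> \<mu>"
  fix i j assume "i < dim_row (?V * Lambda_mat n \<tau> \<mu>)" "j < dim_col (?V * Lambda_mat n \<tau> \<mu>)"
  then have ij: "i < n + 1" "j < n + 1" by (auto simp: V_mat_def Lambda_mat_def mat_diag_def)
  define m where "m = \<mu> (j + 1)"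
  define t where "t = complex_of_real \<tau>"
  define b where "b = complex_of_real \<beta>"
  have m: "m \<in> mu_roots n (\<beta> / \<tau>\<^sup>2)"
    using \<mu> ij by (auto simp: m_def bij_betw_def)
  then have m0: "m \<noteq> 0" using zero_one_notin_mu_roots(1)[OF c] by metis
  have t0: "t \<noteq> 0" and b0: "b \<noteq> 0" using \<tau> \<beta> by (auto simp: t_def b_def)
  have "m ^ (n + 2) + (b / t\<^sup>2 - 1) * m = b / t\<^sup>2"
    using mu_rootsD[OF m] by (simp add: b_def t_def)
  then have key: "t\<^sup>2 * m ^ (n + 2) + (b - t\<^sup>2) * m = b"
    using t0 by (simp add: field_simps)
  define f where "f = (\<lambda>l. if i = 0 \<and> l = 0 then 1 / t + t / b
     else if i = 0 \<and> l = n then 1 / b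
     else if 1 \<le> i \<and> l = 0 then - 1
     else if 1 \<le> i \<and> l = i then 1 / t
     else if 2 \<le> i \<and> l = i - 1 then - 1 / t
     else 0)"
  define g where "g = (\<lambda>l :: nat. if l = 0 then (m - 1) / t else m ^ (l + 1) - m)"
  have V: "?V $$ (l, j) = g l" if "l < n + 1" for l
    using that ij by (simp add: V_mat_def m_def t_def g_def)
  have B: "?B $$ (i, l) = f l" if "l < n + 1" for l
    using that ij by (simp add: B_mat_def t_def b_def f_def)
  have "(?B * ?V) $$ (i, j) = (\<Sum>l < n + 1. ?B $$ (i, l) * ?V $$ (l, j))"
    using ij by (auto simp: B_mat_def V_mat_def scalar_prod_def lessThan_atLeast0 intro!: sum.cong)
  also have "\<dots> = (\<Sum>l < n + 1. f l * g l)"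
    by (intro sum.cong) (simp_all only: lessThan_iff B V)
  also have "\<dots> = g i * ((1 - 1 / m) / t)"
  proof -
    consider "i = 0" | "i = 1" | "i \<ge> 2" by linarith
    then show ?thesis
    proof cases
      case 1
      have "(\<Sum>l < n + 1. f l * g l) = (\<Sum>l \<in> {0, n}. f l * g l)"
        by (rule sum.mono_neutral_right) (use 1 n in \<open>auto simp: f_def\<close>)
      also have "\<dots> = (1 / t + t / b) * ((m - 1) / t) + (m ^ (n + 1) - m) / b"
        using n 1 ij by (simp add: f_def g_def)
      also have "\<dots> = (m - 1) / t * ((1 - 1 / m) / t)"
      proof -
        have "(1 / t + t / b) * ((m - 1) / t) + (m ^ (n + 1) - m) / b
            = ((b + t\<^sup>2) * (m - 1) * m + t\<^sup>2 * (m ^ (n + 1) - m) * m) / (t\<^sup>2 * b * m)"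
          using t0 b0 m0 by (simp add: field_simps power2_eq_square)
        also have "(b + t\<^sup>2) * (m - 1) * m + t\<^sup>2 * (m ^ (n + 1) - m) * m
            = b * (m - 1)\<^sup>2 + ((t\<^sup>2 * m ^ (n + 2) + (b - t\<^sup>2) * m) - b)"
          by (simp add: algebra_simps power2_eq_square)
        also have "\<dots> = b * (m - 1)\<^sup>2" unfolding key by simp
        also have "b * (m - 1)\<^sup>2 / (t\<^sup>2 * b * m) = (m - 1) / t * ((1 - 1 / m) / t)"
          using t0 b0 m0 by (simp add: field_simps power2_eq_square)
        finally show ?thesis .
      qed
      finally show ?thesis using 1 by (simp add: g_def)
    next
      case 2
      have "(\<Sum>l < n + 1. f l * g l) = (\<Sum>l \<in> {0, 1}. f l * g l)"
        by (rule sum.mono_neutral_right) (use 2 n in \<open>auto simp: f_def\<close>)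
      also have "\<dots> = - ((m - 1) / t) + (m ^ 2 - m) / t"
        using n 2 ij by (simp add: f_def g_def power2_eq_square minus_divide_left)
      also have "\<dots> = (m ^ 2 - m) * ((1 - 1 / m) / t)"
        using t0 m0 by (simp add: field_simps power2_eq_square)
      finally show ?thesis using 2 by (simp add: g_def power2_eq_square)
    next
      case 3
      have "(\<Sum>l < n + 1. f l * g l) = (\<Sum>l \<in> {0, i - 1, i}. f l * g l)"
        by (rule sum.mono_neutral_right) (use 3 ij in \<open>auto simp: f_def\<close>)
      also have "\<dots> = f 0 * g 0 + f (i - 1) * g (i - 1) + f i * g i"
        using 3 by simp
      also have "\<dots> = - 1 * ((m - 1) / t) + - 1 / t * (m ^ i - m) + 1 / t * (m ^ (i + 1) - m)"
        using 3 by (simp only: f_def g_def) auto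
      also have "\<dots> = (m ^ (i + 1) - m) * ((1 - 1 / m) / t)"
        using t0 m0 by (simp add: field_simps)
      finally show ?thesis using 3 by (simp add: g_def)
    qed
  qed
  also have "\<dots> = ?V $$ (i, j) * ((1 - 1 / m) / t)" using V ij by simp
  also have "\<dots> = (?V * Lambda_mat n \<tau> \<mu>) $$ (i, j)"
    unfolding Lambda_mat_def
    by (subst mat_diag_mult_right[of _ "n + 1"]) (use ij in \<open>auto simp: V_mat_def m_def t_def\<close>)
  finally show "(?B * ?V) $$ (i, j) = (?V * Lambda_mat n \<tau> \<mu>) $$ (i, j)" .
qed (auto simp: B_mat_def V_mat_def Lambda_mat_def mat_diag_def)

lemma det_V_nonzero:
  assumes \<tau>: "\<tau> > 0" and c: "c > 1" and \<mu>: "bij_betw \<mu> {1..n + 1} (mu_roots n c)"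
  shows "det (V_mat n \<tau> \<mu>) \<noteq> 0"
proof
  let ?V = "V_mat n \<tau> \<mu>" and ?t = "complex_of_real \<tau>"
  have Vc: "?V \<in> carrier_mat (n + 1) (n + 1)" by (simp add: V_mat_def)
  assume "det ?V = 0"
  then have "det (transpose_mat ?V) = 0" using det_transpose[OF Vc] by simp
  then obtain v where v: "v \<in> carrier_vec (n + 1)" "v \<noteq> 0\<^sub>v (n + 1)"
    "transpose_mat ?V *\<^sub>v v = 0\<^sub>v (n + 1)"
    using det_0_iff_vec_prod_zero_field[of "transpose_mat ?V" "n + 1"] Vc by auto
  define q :: "complex poly" where
    "q = smult (v $ 0 / ?t) [:- 1, 1:] + (\<Sum>k = 1..n. smult (v $ k) (monom 1 (k + 1) - monom 1 1))"
  have pq: "poly q z = v $ 0 * ((z - 1) / ?t) + (\<Sum>k = 1..n. v $ k * (z ^ (k + 1) - z))" for z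
    by (simp add: q_def poly_sum poly_monom algebra_simps diff_divide_distrib)
  have deg: "degree q \<le> n + 1"
    unfolding q_def
    by (intro degree_add_le degree_sum_le order.trans[OF degree_smult_le] degree_diff_le)
      (auto intro: order.trans[OF degree_monom_le])
  have root: "poly q z = 0" if "z \<in> mu_roots n c" for z
  proof -
    from that \<mu> obtain j where "j \<in> {1..n + 1}" and "z = \<mu> j"
      unfolding bij_betw_def by blast
    then have j: "j - 1 < n + 1" "z = \<mu> ((j - 1) + 1)" by auto
    then obtain j where j: "j < n + 1" "z = \<mu> (j + 1)" by blast
    have "0 = (transpose_mat ?V *\<^sub>v v) $ j" using v(3) j by simp
    also have "\<dots> = (\<Sum>l < n + 1. ?V $$ (l, j) * v $ l)"
      using j v(1) by (auto simp: V_mat_def scalar_prod_def lessThan_atLeast0 intro!: sum.cong)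
    also have "{..<n + 1} = insert 0 {1..n}" by auto
    also have "(\<Sum>l \<in> insert 0 {1..n}. ?V $$ (l, j) * v $ l) = poly q z"
      unfolding pq using j by (auto simp: V_mat_def algebra_simps intro!: sum.cong)
    finally show ?thesis by simp
  qed
  have "q = 0"
  proof (rule ccontr)
    assume "q \<noteq> 0"
    then have fin: "finite {z. poly q z = 0}" by (rule poly_roots_finite)
    have "insert 1 (mu_roots n c) \<subseteq> {z. poly q z = 0}"
      using root by (auto simp: pq)
    then have "card (insert 1 (mu_roots n c)) \<le> card {z. poly q z = 0}"
      by (rule card_mono[OF fin])
    also have "\<dots> \<le> degree q" by (rule card_poly_roots_bound[OF \<open>q \<noteq> 0\<close>])
    finally show False
      using deg card_mu_roots[OF c, of n] zero_one_notin_mu_roots(2)[OF c, of n] by simp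
  qed
  have vk: "v $ k = 0" if "k \<in> {1..n}" for k
  proof -
    have "coeff (smult a [:- 1, 1 :: complex:]) (k + 1) = 0" for a using that by (cases k) simp_all
    then have "coeff q (k + 1) = (\<Sum>l = 1..n. v $ l * (if l = k then 1 else 0))"
      using that by (simp add: q_def coeff_sum del: smult_pCons)
    also have "\<dots> = (\<Sum>l = 1..n. if l = k then v $ l else 0)"
      by (intro sum.cong) auto
    also have "\<dots> = v $ k" using that by simp
    finally show ?thesis using \<open>q = 0\<close> by simp
  qed
  have "v $ 0 = 0"
    using pq[of 0] \<open>q = 0\<close> \<tau> by simp
  then have "v = 0\<^sub>v (n + 1)"
    using v(1) vk by (intro eq_vecI) (auto, metis Suc_leI atLeastAtMost_iff less_Suc_eq_le not_gr_zero One_nat_def)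
  with v(2) show False by contradiction
qed

text \<open>When \<open>c > 1\<close>, asking for \<open>B = V \<Lambda> W\<close> in the sense of \<^const>\<open>similar_mat_wit\<close>
  (which includes \<open>V W = W V = 1\<close>) imposes nothing beyond \<open>W = V\<^sup>-\<^sup>1\<close>, and such a \<open>W\<close> exists.\<close>

theorem similar_mat_wit_B_iff:
  assumes n: "n \<ge> 1" and \<tau>: "\<tau> > 0" and \<beta>: "\<beta> > 0" and c: "\<beta> / \<tau>\<^sup>2 > 1"
    and \<mu>: "bij_betw \<mu> {1..n + 1} (mu_roots n (\<beta> / \<tau>\<^sup>2))"
  shows "similar_mat_wit (map_mat complex_of_real (B_mat n (1 / \<tau> + \<tau> / \<beta>) \<beta> \<tau>))
           (Lambda_mat n \<tau> \<mu>) (V_mat n \<tau> \<mu>) W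
       \<longleftrightarrow> W \<in> carrier_mat (n + 1) (n + 1) \<and> V_mat n \<tau> \<mu> * W = 1\<^sub>m (n + 1)"
    (is "similar_mat_wit ?B ?L ?V W \<longleftrightarrow> ?R W")
    and "\<exists>!W. similar_mat_wit (map_mat complex_of_real (B_mat n (1 / \<tau> + \<tau> / \<beta>) \<beta> \<tau>))
           (Lambda_mat n \<tau> \<mu>) (V_mat n \<tau> \<mu>) W"
proof -
  have carr: "?V \<in> carrier_mat (n + 1) (n + 1)" "?L \<in> carrier_mat (n + 1) (n + 1)"
    "?B \<in> carrier_mat (n + 1) (n + 1)"
    by (auto simp: V_mat_def Lambda_mat_def B_mat_def)
  have inv: "W * ?V = 1\<^sub>m (n + 1)" if "?R W" for W
    using that mat_mult_left_right_inverse[OF carr(1)] by blast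
  have iff: "similar_mat_wit ?B ?L ?V W \<longleftrightarrow> ?R W" for W
  proof
    assume "similar_mat_wit ?B ?L ?V W"
    from similar_mat_witD2[OF carr(3) this] show "?R W" by blast
  next
    assume R: "?R W"
    have "?B = ?B * (?V * W)" using R carr by simp
    also have "\<dots> = ?B * ?V * W" using R carr by (simp add: assoc_mult_mat[of _ "n+1" "n+1" _ "n+1" _ "n+1"])
    also have "\<dots> = ?V * ?L * W" using B_V_eq_V_Lambda[OF assms] by simp
    finally have BVLW: "?B = ?V * ?L * W" .
    show "similar_mat_wit ?B ?L ?V W"
      by (rule similar_mat_witI[OF _ inv[OF R] BVLW carr(3,2,1)]) (use R in auto)
  qed
  show "similar_mat_wit ?B ?L ?V W \<longleftrightarrow> ?R W" by (rule iff)
  have "\<exists>W. ?R W"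
    using det_non_zero_imp_unit[OF carr(1) det_V_nonzero[OF \<tau> c \<mu>], of "()"]
    by (auto simp: Units_def ring_mat_simps)
  then obtain W where W: "?R W" by blast
  have "W' = W" if "?R W'" for W'
  proof -
    have "W' = (W * ?V) * W'" using that inv[OF W] left_mult_one_mat[of W' "n + 1" "n + 1"] by metis
    also have "\<dots> = W * (?V * W')"
      using that W carr by (intro assoc_mult_mat) auto
    also have "\<dots> = W" using that W right_mult_one_mat[of W "n + 1" "n + 1"] by metis
    finally show ?thesis .
  qed
  with W show "\<exists>!W. similar_mat_wit ?B ?L ?V W" unfolding iff by blast
qed

end

theory Submission
  imports Defs
begin

text \<open>For a root \<open>x = \<mu>\<^sub>j\<close> put \<open>E x = (n + 1) x\<^bsup>n+2\<^esup> + c\<close>. Interpolating at the roots and at \<open>1\<close> gives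
  the rows of \<open>W = V\<^sup>-\<^sup>1\<close> in closed form: \<open>- \<tau> c / E x\<close> in column \<open>0\<close> and \<open>x\<^bsup>n+1-i\<^esup> / E x\<close> in column
  \<open>i \<ge> 1\<close>. The roots satisfy \<open>1 \<le> \<bar>x\<bar>\<close> and \<open>\<bar>x\<bar>\<^bsup>n+1\<^esup> \<le> 2c\<close>, whence \<open>\<parallel>V\<parallel> = O(cn)\<close>. That \<open>\<parallel>W\<parallel> = O(1)\<close> rests on
  \<open>\<bar>E x\<bar> \<ge> c / 2\<close>: otherwise \<open>x\<^bsup>n+2\<^esup>\<close> has negative real part, while the equation
  \<open>x\<^bsup>n+2\<^esup> = c - (c - 1) x\<close> forces \<open>x\<close> to be so close to the positive real axis that \<open>x\<^bsup>n+2\<^esup>\<close> has positive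
  real part.\<close>

section \<open>Powers of numbers close to 1\<close>

lemma norm_one_plus_power_diff_le:
  fixes u :: "'a::real_normed_algebra_1"
  shows "norm ((1 + u) ^ N - 1) \<le> (1 + norm u) ^ N - 1"
\<comment> \<open>The underlying reason is that \<open>(1 + u) ^ N - 1\<close> expands in powers of
  \<open>u\<close> with nonnegative coefficients.\<close>
proof (induction N)
  case (Suc N)
  have "(1 + u) ^ Suc N - 1 = (1 + u) * ((1 + u) ^ N - 1) + u"
    by (simp add: algebra_simps)
  then have "norm ((1 + u) ^ Suc N - 1) \<le> norm ((1 + u) * ((1 + u) ^ N - 1)) + norm u"
    by (metis norm_triangle_ineq)
  also have "\<dots> \<le> norm (1 + u) * norm ((1 + u) ^ N - 1) + norm u"
    by (simp add: norm_mult_ineq)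
  also have "\<dots> \<le> (1 + norm u) * ((1 + norm u) ^ N - 1) + norm u"
    using Suc.IH norm_triangle_ineq[of 1 u] by (intro add_right_mono mult_mono) auto
  finally show ?case by (simp add: algebra_simps)
qed simp

text \<open>The power stays in the open unit disc around 1, because \<open>(1 + cmod u) ^ N\<close>
  is at most exp(1/2), which is below 2.\<close>

lemma Re_one_plus_power_pos:
  fixes u :: complex
  assumes "real N * cmod u \<le> 1 / 2"
  shows "Re ((1 + u) ^ N) > 0"
proof -
  have "(1 + cmod u) ^ N \<le> exp (cmod u) ^ N"
    by (intro power_mono) auto
  also have "\<dots> = exp (real N * cmod u)" by (simp add: exp_of_nat_mult)
  also have "\<dots> \<le> exp (1 / 2)" using assms by simp
  also have "\<dots> < 2"
  proof (rule power2_less_imp_less)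
    have "exp (1 / 2 :: real) ^ 2 = exp 1" by (simp flip: exp_of_nat_mult)
    then show "exp (1 / 2 :: real) ^ 2 < 2 ^ 2" using exp_le by simp
  qed simp
  finally have "cmod ((1 + u) ^ N - 1) < 1"
    using norm_one_plus_power_diff_le[of u N] by linarith
  then show ?thesis using abs_Re_le_cmod[of "(1 + u) ^ N - 1"] by simp
qed

section \<open>Size of the roots and of \<open>E_val\<close> at them\<close>

lemma mu_roots_norm_ge_1:
  assumes "c > 1" "z \<in> mu_roots n c"
  shows "cmod z \<ge> 1"
proof (rule ccontr)
  assume "\<not> ?thesis"
  then have z: "cmod z < 1" by simp
  \<comment> \<open>Inside the unit disc, \<open>z ^ (n + 2) + (c - 1) * z\<close> has modulus below
    \<open>1 + (c - 1)\<close>, so it cannot equal \<open>c\<close>.\<close>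
  have "c = cmod (complex_of_real c)" using assms by simp
  also have "\<dots> = cmod (z ^ (n + 2) + complex_of_real (c - 1) * z)"
    using mu_rootsD[OF assms(2)] by simp
  also have "\<dots> \<le> cmod z ^ (n + 2) + (c - 1) * cmod z"
    using assms by (intro norm_triangle_le) (simp add: norm_mult norm_power del: of_real_diff)
  also have "\<dots> < 1 + (c - 1) * 1"
  proof (intro add_strict_mono mult_strict_left_mono)
    show "cmod z ^ (n + 2) < 1" using z by (subst power_less_one_iff) auto
  qed (use assms z in auto)
  finally show False by simp
qed

lemma mu_roots_norm_power_le:
  assumes "c > 1" "z \<in> mu_roots n c" "k \<le> n + 1"
  shows "cmod z ^ k \<le> 2 * c"
proof -
  have z1: "cmod z \<ge> 1" by (rule mu_roots_norm_ge_1[OF assms(1,2)])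
  have "z ^ (n + 2) = complex_of_real c - complex_of_real (c - 1) * z"
    using mu_rootsD[OF assms(2)] by (simp add: algebra_simps)
  then have "cmod z ^ (n + 2) = cmod (complex_of_real c - complex_of_real (c - 1) * z)"
    by (metis norm_power)
  also have "\<dots> \<le> c + (c - 1) * cmod z"
    using assms norm_triangle_ineq4[of "complex_of_real c" "complex_of_real (c - 1) * z"]
    by (simp add: norm_mult del: of_real_diff)
  \<comment> \<open>A factor \<open>cmod z\<close> is extracted so that it can be cancelled, which
    leaves the exponent \<open>n + 1\<close>.\<close>
  also have "\<dots> \<le> 2 * c * cmod z"
  proof -
    have "c \<le> c * cmod z" using z1 assms(1) by simp
    then show ?thesis using z1 by (simp add: algebra_simps)
  qed
  finally have "cmod z ^ (n + 1) * cmod z \<le> 2 * c * cmod z" by (simp add: mult.commute)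
  then have "cmod z ^ (n + 1) \<le> 2 * c" using z1 by (simp only: mult_le_cancel_right)
  moreover have "cmod z ^ k \<le> cmod z ^ (n + 1)"
    using z1 assms(3) by (intro power_increasing)
  ultimately show ?thesis by linarith
qed

text \<open>At a root this is \<open>x\<close> times the derivative of
  \<open>x ^ (n + 2) + (c - 1) * x - c\<close>, hence the natural denominator in Lagrange
  interpolation at the roots and 1.\<close>

definition E_val :: "nat \<Rightarrow> real \<Rightarrow> complex \<Rightarrow> complex" where
  "E_val n c x = of_nat (n + 1) * x ^ (n + 2) + complex_of_real c"

lemma norm_E_val_ge:
  assumes c: "c > 1" and z: "z \<in> mu_roots n c"
  shows "cmod (E_val n c z) \<ge> c / 2"
proof (rule ccontr)
  assume "\<not> ?thesis"
  then have small: "cmod (E_val n c z) < c / 2" by simp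
  \<comment> \<open>The root equation turns \<open>c * (n + 2) - E_val n c z\<close> into
    \<open>(n + 1) * (c - 1) * z\<close>. Hence \<open>z = r * (1 + u)\<close>, where
    \<open>r\<close> is the positive value that a vanishing \<open>E_val\<close> would force on
    \<open>z\<close>.\<close>
  define u where "u = - E_val n c z / complex_of_real (c * real (n + 2))"
  define r where "r = c * real (n + 2) / (real (n + 1) * (c - 1))"
  have r: "r > 0" using c by (simp add: r_def)
  have "real (n + 2) * cmod u = cmod (E_val n c z) / c"
    using c unfolding u_def norm_divide norm_minus_cancel norm_of_real by (simp add: abs_mult)
  also have "\<dots> \<le> 1 / 2" using small c by (simp add: field_simps)
  finally have pos: "Re ((1 + u) ^ (n + 2)) > 0" by (rule Re_one_plus_power_pos)
  have "complex_of_real (c * real (n + 2)) \<noteq> 0"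
    unfolding of_real_eq_0_iff using c by simp
  then have "complex_of_real (c * real (n + 2)) * u = - E_val n c z"
    unfolding u_def by (subst times_divide_eq_right) (rule nonzero_mult_div_cancel_left)
  then have "complex_of_real (c * real (n + 2)) * (1 + u)
      = complex_of_real (c * real (n + 2)) - E_val n c z"
    unfolding distrib_left by simp
  also have "\<dots> = of_nat (n + 1) * (complex_of_real c - z ^ (n + 2))"
    by (simp add: E_val_def algebra_simps)
  also have "\<dots> = complex_of_real (real (n + 1) * (c - 1)) * z"
    by (subst mu_rootsD[OF z, symmetric]) (simp add: algebra_simps)
  finally have e: "complex_of_real (c * real (n + 2)) * (1 + u)
      = complex_of_real (real (n + 1) * (c - 1)) * z" .
  have "complex_of_real (real (n + 1) * (c - 1)) \<noteq> 0"
    unfolding of_real_eq_0_iff using c by simp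
  then have "z = complex_of_real r * (1 + u)"
    unfolding r_def of_real_divide times_divide_eq_left e by simp
  then have "z ^ (n + 2) = complex_of_real (r ^ (n + 2)) * (1 + u) ^ (n + 2)"
    by (simp only: power_mult_distrib of_real_power)
  then have "Re (z ^ (n + 2)) = r ^ (n + 2) * Re ((1 + u) ^ (n + 2))"
    by (simp only: Re_complex_of_real Im_complex_of_real times_complex.sel)
  then have "Re (z ^ (n + 2)) > 0"
    using pos r by (simp only: zero_less_mult_iff zero_less_power) simp
  then have "real (n + 1) * Re (z ^ (n + 2)) > 0" by (intro mult_pos_pos) auto
  moreover have "Re (E_val n c z) = real (n + 1) * Re (z ^ (n + 2)) + c"
    unfolding E_val_def by (simp only: plus_complex.sel times_complex.sel Re_complex_of_real) simp
  ultimately have "c < Re (E_val n c z)" by linarith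
  then show False using small complex_Re_le_cmod[of "E_val n c z"] c by linarith
qed

text \<open>By definition \<open>(n + 1) * z ^ (n + 2)\<close> is \<open>E_val\<close> minus
  \<open>c\<close>, and \<open>c\<close> is at most twice the modulus of \<open>E_val\<close>. Lower
  powers are no larger since \<open>cmod z\<close> is at least 1. The factor
  \<open>1 / (n + 1)\<close> compensates for the \<open>n + 1\<close> entries in a column of the
  inverse.\<close>

lemma norm_power_over_E_val_le:
  assumes c: "c > 1" and z: "z \<in> mu_roots n c" and k: "k \<le> n + 2"
  shows "cmod (z ^ k / E_val n c z) \<le> 3 / real (n + 1)"
proof -
  have E: "cmod (E_val n c z) \<ge> c / 2" by (rule norm_E_val_ge[OF c z])
  have "real (n + 1) * cmod z ^ k \<le> real (n + 1) * cmod z ^ (n + 2)"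
    using mu_roots_norm_ge_1[OF c z] k by (intro mult_left_mono power_increasing) auto
  also have "\<dots> = cmod (E_val n c z - complex_of_real c)"
    by (simp add: E_val_def norm_mult norm_power del: of_nat_add of_nat_Suc)
  also have "\<dots> \<le> cmod (E_val n c z) + c"
    using c norm_triangle_ineq4[of "E_val n c z" "complex_of_real c"] by simp
  also have "\<dots> \<le> 3 * cmod (E_val n c z)" using E by simp
  finally show ?thesis
    using E c unfolding norm_divide norm_power
    by (subst frac_le_eq) (auto simp: divide_le_0_iff mult.commute)
qed

section \<open>The inverse of the eigenvector matrix in closed form\<close>

definition W_mat :: "nat \<Rightarrow> real \<Rightarrow> real \<Rightarrow> (nat \<Rightarrow> complex) \<Rightarrow> complex mat" where
  "W_mat n c \<tau> \<mu> = mat (n + 1) (n + 1) (\<lambda>(j, i).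
     (if i = 0 then - complex_of_real (\<tau> * c) else \<mu> (j + 1) ^ (n + 1 - i)) / E_val n c (\<mu> (j + 1)))"

text \<open>As a polynomial in \<open>y\<close>, this is \<open>E_val n c x\<close> times the
  Lagrange basis polynomial that is 1 at \<open>x\<close> and 0 at 1 and at the other roots. The
  left side expands it in the rows of \<open>V_mat\<close>, all of which vanish at 1. The equation
  defining \<open>x\<close> collapses the terms linear in \<open>y\<close>.\<close>

lemma interpolation_sum:
  assumes x: "x \<in> mu_roots n c"
  shows "- complex_of_real c * (y - 1) + (\<Sum>i = 1..n. x ^ (n + 1 - i) * (y ^ (i + 1) - y))
       = complex_of_real c + x * y * (\<Sum>i = 0..n. x ^ (n - i) * y ^ i)"
proof -
  have "(\<Sum>i = 1..n. x ^ (n + 1 - i)) = (\<Sum>k = 1..n. x ^ k)"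
    by (rule sum.reindex_bij_witness[of _ "\<lambda>k. n + 1 - k" "\<lambda>k. n + 1 - k"]) auto
  also have "\<dots> = - complex_of_real c - x ^ (n + 1)"
    using x by (simp add: mu_roots_def eq_neg_iff_add_eq_0 algebra_simps)
  finally have s: "(\<Sum>i = 1..n. x ^ (n + 1 - i)) = - complex_of_real c - x ^ (n + 1)" .
  have "(\<Sum>i = 1..n. x ^ (n + 1 - i) * (y ^ (i + 1) - y))
      = (\<Sum>i = 1..n. x * y * (x ^ (n - i) * y ^ i)) - y * (\<Sum>i = 1..n. x ^ (n + 1 - i))"
    by (simp add: sum_subtractf[symmetric] sum_distrib_left algebra_simps Suc_diff_le)
  also have "(\<Sum>i = 1..n. x * y * (x ^ (n - i) * y ^ i))
      = x * y * (\<Sum>i = 0..n. x ^ (n - i) * y ^ i) - x * y * x ^ n"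
    by (simp add: sum_distrib_left[symmetric] sum.atLeast_Suc_atMost[of 0] algebra_simps)
  finally show ?thesis unfolding s by (simp add: algebra_simps)
qed

lemma homogeneous_sum_at_roots:
  assumes x: "x \<in> mu_roots n c" and y: "y \<in> mu_roots n c"
  shows "complex_of_real c + x * y * (\<Sum>i = 0..n. x ^ (n - i) * y ^ i)
       = (if x = y then E_val n c x else 0)"
proof (cases "x = y")
  case True
  have "(\<Sum>i = 0..n. x ^ (n - i) * x ^ i) = of_nat (n + 1) * x ^ n"
    by (simp add: power_add[symmetric])
  with True show ?thesis by (simp add: E_val_def algebra_simps)
next
  case False
  let ?S = "\<Sum>i = 0..n. x ^ (n - i) * y ^ i"
  have S: "(x - y) * ?S = x ^ (n + 1) - y ^ (n + 1)"
    unfolding atLeast0AtMost using diff_power_eq_sum[of y n x]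
    by (simp add: lessThan_Suc_atMost algebra_simps)
  \<comment> \<open>Multiplication by \<open>x - y\<close> telescopes the sum; substituting the two
    root equations then cancels everything.\<close>
  have "(x - y) * (complex_of_real c + x * y * ?S)
      = complex_of_real c * (x - y) + x * y * ((x - y) * ?S)"
    by (simp add: algebra_simps)
  also have "\<dots> = complex_of_real c * (x - y) + y * x ^ (n + 2) - x * y ^ (n + 2)"
    unfolding S by (simp add: algebra_simps)
  also have "x ^ (n + 2) = complex_of_real c - (complex_of_real c - 1) * x"
    using mu_rootsD[OF x] by (simp add: algebra_simps)
  also have "y ^ (n + 2) = complex_of_real c - (complex_of_real c - 1) * y"
    using mu_rootsD[OF y] by (simp add: algebra_simps)
  finally have "(x - y) * (complex_of_real c + x * y * ?S) = 0"
    by (simp add: algebra_simps)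
  with False show ?thesis by simp
qed

lemma W_mat_mult_V_mat:
  assumes \<tau>: "\<tau> > 0" and c: "c > 1" and \<mu>: "bij_betw \<mu> {1..n + 1} (mu_roots n c)"
  shows "W_mat n c \<tau> \<mu> * V_mat n \<tau> \<mu> = 1\<^sub>m (n + 1)"
proof (rule eq_matI)
  fix j k assume "j < dim_row (1\<^sub>m (n + 1))" "k < dim_col (1\<^sub>m (n + 1))"
  then have jk: "j < n + 1" "k < n + 1" by auto
  define x y where "x = \<mu> (j + 1)" and "y = \<mu> (k + 1)"
  have x: "x \<in> mu_roots n c" and y: "y \<in> mu_roots n c"
    using \<mu> jk by (auto simp: x_def y_def bij_betw_def)
  have xy: "x = y \<longleftrightarrow> j = k"
    using \<mu> jk by (auto simp: x_def y_def bij_betw_def dest: inj_onD)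
  have E: "E_val n c x \<noteq> 0" using norm_E_val_ge[OF c x] c by auto
  have "(W_mat n c \<tau> \<mu> * V_mat n \<tau> \<mu>) $$ (j, k)
      = (\<Sum>i < n + 1. W_mat n c \<tau> \<mu> $$ (j, i) * V_mat n \<tau> \<mu> $$ (i, k))"
    using jk by (auto simp: W_mat_def V_mat_def scalar_prod_def lessThan_atLeast0 intro!: sum.cong)
  \<comment> \<open>Index 0 is split off: there the factor \<tau> in \<open>W_mat\<close> cancels
    the division by \<tau> in \<open>V_mat\<close>.\<close>
  also have "{..<n + 1} = insert 0 {1..n}" by auto
  also have "(\<Sum>i \<in> insert 0 {1..n}. W_mat n c \<tau> \<mu> $$ (j, i) * V_mat n \<tau> \<mu> $$ (i, k))
      = - complex_of_real c * (y - 1) / E_val n c x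
        + (\<Sum>i = 1..n. x ^ (n + 1 - i) * (y ^ (i + 1) - y) / E_val n c x)"
    using jk \<tau> by (auto simp: W_mat_def V_mat_def x_def y_def intro!: sum.cong)
  also have "\<dots> = (if x = y then E_val n c x else 0) / E_val n c x"
    unfolding sum_divide_distrib[symmetric] add_divide_distrib[symmetric]
      interpolation_sum[OF x] homogeneous_sum_at_roots[OF x y] ..
  also have "\<dots> = 1\<^sub>m (n + 1) $$ (j, k)" using E xy jk by simp
  finally show "(W_mat n c \<tau> \<mu> * V_mat n \<tau> \<mu>) $$ (j, k) = 1\<^sub>m (n + 1) $$ (j, k)" .
qed (auto simp: W_mat_def V_mat_def)

section \<open>Norm bounds for both matrices and the condition number\<close>

lemma norm_1_le:
  assumes "dim_col A > 0"
    and "\<And>j. j < dim_col A \<Longrightarrow> (\<Sum>i<dim_row A. cmod (A $$ (i, j))) \<le> b"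
  shows "norm_1 A \<le> b"
  unfolding norm_1_def using assms by (subst Max_le_iff) auto

lemma norm_1_V_mat_le:
  assumes \<tau>: "\<tau> > 0" and c: "c > 1" and \<mu>: "bij_betw \<mu> {1..n + 1} (mu_roots n c)"
  shows "norm_1 (V_mat n \<tau> \<mu>) \<le> 3 * c / \<tau> + 4 * c * real n"
proof (rule norm_1_le)
  fix j assume "j < dim_col (V_mat n \<tau> \<mu>)"
  then have j: "j < n + 1" by (simp add: V_mat_def)
  define z where "z = \<mu> (j + 1)"
  have z: "z \<in> mu_roots n c" using \<mu> j by (auto simp: z_def bij_betw_def)
  have p: "cmod (z ^ k) \<le> 2 * c" if "k \<le> n + 1" for k
    using mu_roots_norm_power_le[OF c z that] by (simp add: norm_power)
  have "{..<n + 1} = insert 0 {1..n}" by auto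
  then have "(\<Sum>i<dim_row (V_mat n \<tau> \<mu>). cmod (V_mat n \<tau> \<mu> $$ (i, j)))
      = (\<Sum>i\<in>insert 0 {1..n}. cmod (V_mat n \<tau> \<mu> $$ (i, j)))"
    by (simp add: V_mat_def)
  also have "\<dots> = cmod (z - 1) / \<tau> + (\<Sum>i = 1..n. cmod (z ^ (i + 1) - z))"
    using j \<tau> by (auto simp: V_mat_def z_def norm_divide intro!: sum.cong)
  \<comment> \<open>Powers of \<open>z\<close> up to \<open>n + 1\<close> have modulus at most
    \<open>2 * c\<close>, and \<open>1 < c\<close> absorbs the 1 in \<open>z - 1\<close>.\<close>
  also have "\<dots> \<le> 3 * c / \<tau> + (\<Sum>i = 1..n. 4 * c)"
  proof (intro add_mono divide_right_mono sum_mono)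
    show "cmod (z - 1) \<le> 3 * c"
      using norm_triangle_ineq4[of z 1] p[of 1] c by simp
    fix i assume "i \<in> {1..n}"
    then show "cmod (z ^ (i + 1) - z) \<le> 4 * c"
      using norm_triangle_ineq4[of "z ^ (i + 1)" z] p[of 1] p[of "i + 1"] by simp
  qed (use \<tau> in auto)
  finally show "(\<Sum>i<dim_row (V_mat n \<tau> \<mu>). cmod (V_mat n \<tau> \<mu> $$ (i, j)))
    \<le> 3 * c / \<tau> + 4 * c * real n" by (simp add: algebra_simps)
qed (simp add: V_mat_def)

lemma norm_1_W_mat_le:
  assumes \<tau>: "\<tau> > 0" and c: "c > 1" and \<mu>: "bij_betw \<mu> {1..n + 1} (mu_roots n c)"
  shows "norm_1 (W_mat n c \<tau> \<mu>) \<le> 2 * \<tau> * real (n + 1) + 3"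
proof (rule norm_1_le)
  fix i assume "i < dim_col (W_mat n c \<tau> \<mu>)"
  then have i: "i < n + 1" by (simp add: W_mat_def)
  \<comment> \<open>The first summand bounds column 0, the second all other columns; their sum
    serves both cases.\<close>
  have "cmod (W_mat n c \<tau> \<mu> $$ (j, i)) \<le> 2 * \<tau> + 3 / real (n + 1)" if j: "j < n + 1" for j
  proof -
    define z where "z = \<mu> (j + 1)"
    have z: "z \<in> mu_roots n c" using \<mu> j by (auto simp: z_def bij_betw_def)
    show ?thesis
    proof (cases "i = 0")
      case True
      have E: "cmod (E_val n c z) \<ge> c / 2" by (rule norm_E_val_ge[OF c z])
      have "cmod (W_mat n c \<tau> \<mu> $$ (j, i)) = \<tau> * c / cmod (E_val n c z)"
        using True i j \<tau> c by (simp add: W_mat_def z_def norm_divide norm_mult)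
      also have "\<dots> \<le> 2 * \<tau>"
        using mult_left_mono[OF E, of "2 * \<tau>"] E c \<tau> by (subst pos_divide_le_eq) auto
      finally show ?thesis by (smt (verit) divide_nonneg_nonneg of_nat_0_le_iff)
    next
      case False
      then have "cmod (W_mat n c \<tau> \<mu> $$ (j, i)) \<le> 3 / real (n + 1)"
        using i j norm_power_over_E_val_le[OF c z, of "n + 1 - i"] by (simp add: W_mat_def z_def)
      then show ?thesis using \<tau> by linarith
    qed
  qed
  then have "(\<Sum>j<n + 1. cmod (W_mat n c \<tau> \<mu> $$ (j, i)))
      \<le> (\<Sum>j<n + 1. 2 * \<tau> + 3 / real (n + 1))"
    by (intro sum_mono) blast
  also have "\<dots> = real (n + 1) * (2 * \<tau> + 3 / real (n + 1))"
    by (simp only: sum_constant card_lessThan)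
  also have "\<dots> = 2 * \<tau> * real (n + 1) + 3"
    by (simp add: distrib_left del: of_nat_add of_nat_Suc)
  finally show "(\<Sum>j<dim_row (W_mat n c \<tau> \<mu>). cmod (W_mat n c \<tau> \<mu> $$ (j, i)))
      \<le> 2 * \<tau> * real (n + 1) + 3" by (simp add: W_mat_def)
qed (simp add: W_mat_def)

lemma norm_1_nonneg:
  assumes "dim_col A > 0"
  shows "norm_1 A \<ge> 0"
  unfolding norm_1_def using assms by (subst Max_ge_iff) (auto intro!: bexI[of _ 0] sum_nonneg)

theorem theorem3p1:
  fixes T :: real
  assumes "T > 0"
  shows "\<exists>C > 0. \<exists>n0 :: nat. \<forall>n \<ge> n0. \<forall>\<beta> > 0. n \<ge> 1 \<longrightarrow>
    (let \<tau> = T / real n; c = \<beta> / \<tau>\<^sup>2; \<alpha> = 1 / \<tau> + \<tau> / \<beta> in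
     c > 1 \<longrightarrow>
     (\<forall>\<mu> W. bij_betw \<mu> {1..n + 1} (mu_roots n c) \<longrightarrow>
       similar_mat_wit (map_mat complex_of_real (B_mat n \<alpha> \<beta> \<tau>)) (Lambda_mat n \<tau> \<mu>)
         (V_mat n \<tau> \<mu>) W \<longrightarrow>
       norm_1 (V_mat n \<tau> \<mu>) * norm_1 W \<le> C * c * real n))"
  unfolding Let_def
\<comment> \<open>With \<open>\<tau> = T / n\<close>, the first factor comes from
  \<open>3 * c / \<tau> + 4 * c * n\<close>, the second from
  \<open>2 * \<tau> * (n + 1) + 3\<close>, using \<open>1 \<le> n\<close>.\<close>
proof (intro exI[of _ "(3 / T + 4) * (4 * T + 3)"] exI[of _ 0] conjI allI impI)
  show "(3 / T + 4) * (4 * T + 3) > 0" using assms by (intro mult_pos_pos add_pos_pos) auto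
  fix n :: nat and \<beta> :: real and \<mu> W
  assume "n \<ge> 0" and \<beta>: "\<beta> > 0" and n: "n \<ge> 1"
  define \<tau> c where "\<tau> = T / real n" and "c = \<beta> / \<tau>\<^sup>2"
  assume "\<beta> / (T / real n)\<^sup>2 > 1" "bij_betw \<mu> {1..n + 1} (mu_roots n (\<beta> / (T / real n)\<^sup>2))"
    "similar_mat_wit (map_mat complex_of_real (B_mat n (1 / (T / real n) + T / real n / \<beta>) \<beta> (T / real n)))
       (Lambda_mat n (T / real n) \<mu>) (V_mat n (T / real n) \<mu>) W"
  then have c: "c > 1" and \<mu>: "bij_betw \<mu> {1..n + 1} (mu_roots n c)"
    and sim: "similar_mat_wit (map_mat complex_of_real (B_mat n (1 / \<tau> + \<tau> / \<beta>) \<beta> \<tau>))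
       (Lambda_mat n \<tau> \<mu>) (V_mat n \<tau> \<mu>) W"
    by (simp_all only: \<tau>_def c_def)
  have \<tau>: "\<tau> > 0" using assms n by (simp add: \<tau>_def)
  have W: "W \<in> carrier_mat (n + 1) (n + 1)" "V_mat n \<tau> \<mu> * W = 1\<^sub>m (n + 1)"
    using similar_mat_wit_B_iff(1)[OF n \<tau> \<beta>, of \<mu> W] c \<mu> sim by (auto simp: c_def)
  have carr: "V_mat n \<tau> \<mu> \<in> carrier_mat (n + 1) (n + 1)" "W_mat n c \<tau> \<mu> \<in> carrier_mat (n + 1) (n + 1)"
    by (simp_all add: V_mat_def W_mat_def)
  \<comment> \<open>A left inverse and a right inverse of the same matrix coincide.\<close>
  have "W = (W_mat n c \<tau> \<mu> * V_mat n \<tau> \<mu>) * W"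
    using W(1) left_mult_one_mat W_mat_mult_V_mat[OF \<tau> c \<mu>] by metis
  also have "\<dots> = W_mat n c \<tau> \<mu> * (V_mat n \<tau> \<mu> * W)"
    by (rule assoc_mult_mat[OF carr(2,1) W(1)])
  also have "\<dots> = W_mat n c \<tau> \<mu>"
    using carr(2) W(2) right_mult_one_mat by metis
  finally have W_eq: "W = W_mat n c \<tau> \<mu>" .
  have "norm_1 W \<le> 2 * \<tau> * real (n + 1) + 3"
    unfolding W_eq by (rule norm_1_W_mat_le[OF \<tau> c \<mu>])
  also have "2 * \<tau> * real (n + 1) = 2 * T + 2 * T / real n"
    using n by (simp add: \<tau>_def field_simps)
  also have "\<dots> + 3 \<le> 4 * T + 3"
    using n assms mult_left_mono[of 1 "real n" "2 * T"] by (simp add: field_simps)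
  finally have Wb: "norm_1 W \<le> 4 * T + 3" .
  have Vb: "norm_1 (V_mat n \<tau> \<mu>) \<le> (3 / T + 4) * c * real n"
    using norm_1_V_mat_le[OF \<tau> c \<mu>] by (simp add: \<tau>_def algebra_simps)
  have "norm_1 (V_mat n \<tau> \<mu>) * norm_1 W \<le> ((3 / T + 4) * c * real n) * (4 * T + 3)"
    using assms c W(1) by (intro mult_mono Vb Wb norm_1_nonneg) auto
  then show "norm_1 (V_mat n (T / real n) \<mu>) * norm_1 W
      \<le> (3 / T + 4) * (4 * T + 3) * (\<beta> / (T / real n)\<^sup>2) * real n"
    by (simp add: \<tau>_def c_def mult.commute mult.left_commute)
qed

end
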